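(* Let $K$ be a field, $d,n>1$ integers, $A=K[x_1,\dots,x_n]$, and let $r\ge0$ be an integer such that $|K|>(r+1)^2/2$ and $\binom{d}{i}\neq0$ in $K$ for $0\le i\le r$. Then any $r+1$ distinct powerpoints of $A_d$ are independent, i.e. if $\langle f_1^d\rangle,\dots,\langle f_{r+1}^d\rangle$ are pairwise distinct powerpoints then $f_1^d,\dots,f_{r+1}^d$ are linearly independent.
   Context: $A_m$ is the space of homogeneous polynomials of degree $m$ in $A$. A powerpoint of $A_d$ is a $1$-space $\langle f^d\rangle$ with $0\ne f\in A_1$. *)

theory Defs
  imports Complex_Main "HOL-Library.Poly_Mapping"
begin

text \<open>
  Polynomials are finitely supported maps from exponent vectors to coefficients, with the
  convolution product of \<^theory>\<open>HOL-Library.Poly_Mapping\<close>. The type has countably many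
  variables, indexed by \<^typ>\<open>nat\<close>; the ring \<open>K[x\<^sub>1,\<dots>,x\<^sub>n]\<close> is the subset \<open>mpolys n\<close> in which only
  the variables with index below \<open>n\<close> occur.
\<close>

type_synonym 'a mpoly = "(nat \<Rightarrow>\<^sub>0 nat) \<Rightarrow>\<^sub>0 'a"

definition mpoly_scale :: "'a::comm_semiring_1 \<Rightarrow> 'a mpoly \<Rightarrow> 'a mpoly" where
  "mpoly_scale c p = Poly_Mapping.map (\<lambda>a. c * a) p"

lemma mpoly_scale_conv_mult: "mpoly_scale c p = Poly_Mapping.single 0 c * p"
  by (simp add: mpoly_scale_def mult_map_scale_conv_mult)

global_interpretation mpoly: vector_space "mpoly_scale :: 'a::field \<Rightarrow> 'a mpoly \<Rightarrow> 'a mpoly"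
  by unfold_locales
    (simp_all add: mpoly_scale_conv_mult distrib_left distrib_right single_add
      mult.assoc [symmetric] mult_single)

definition mpolys :: "nat \<Rightarrow> 'a::zero mpoly set" where
  "mpolys n = {p. \<forall>t \<in> Poly_Mapping.keys p. Poly_Mapping.keys t \<subseteq> {..<n}}"

definition monom_degree :: "(nat \<Rightarrow>\<^sub>0 nat) \<Rightarrow> nat" where
  "monom_degree t = (\<Sum>i \<in> Poly_Mapping.keys t. Poly_Mapping.lookup t i)"

text \<open>The space \<open>A\<^sub>m\<close> of forms of degree \<open>m\<close> in \<open>n\<close> variables; it contains \<open>0\<close>.\<close>

definition forms :: "nat \<Rightarrow> nat \<Rightarrow> 'a::zero mpoly set" where
  "forms n m = {p \<in> mpolys n. \<forall>t \<in> Poly_Mapping.keys p. monom_degree t = m}"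

text \<open>The powerpoint of \<open>A\<^sub>d\<close> given by \<open>f\<close>, to be used for nonzero \<open>f \<in> forms n 1\<close> only.\<close>

definition powerpoint :: "nat \<Rightarrow> 'a::field mpoly \<Rightarrow> 'a mpoly set" where
  "powerpoint d f = mpoly.span {f ^ d}"

end

theory Submission
  imports Defs "HOL-Computational_Algebra.Polynomial"
begin

text \<open>
  Choose a point \<open>u\<close> of \<open>K\<^sup>n\<close> at which no \<open>f\<^sub>i\<close> vanishes, and then a point \<open>v\<close> at which no form
  \<open>f\<^sub>j(u) f\<^sub>i - f\<^sub>i(u) f\<^sub>j\<close> with \<open>j < i\<close> vanishes; these forms are nonzero because the powerpoints
  are distinct. The points exist because \<open>K\<^sup>n\<close> is not a finite union of at most \<open>|K|\<close> hyperplanes, and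
  \<open>r (r + 1) / 2\<close> and \<open>r + 1\<close> are both at most \<open>|K|\<close>. Restricting to the line
  \<open>y \<mapsto> u + y v\<close> sends \<open>f\<^sub>i\<^sup>d\<close> to \<open>(f\<^sub>i(u) + f\<^sub>i(v) y)\<^sup>d\<close>. Since the binomial coefficients are
  nonzero, the coefficients of \<open>1, y, \<dots>, y\<^sup>r\<close> turn a linear relation among the \<open>f\<^sub>i\<^sup>d\<close> into a
  Vandermonde system with the \<open>r + 1\<close> distinct nodes \<open>f\<^sub>i(v) / f\<^sub>i(u)\<close>.
\<close>

section \<open>Points avoiding hyperplanes\<close>

text \<open>Induction on \<open>S\<close>. If the point \<open>u\<close> found for \<open>S\<close>
  lies on the new hyperplane, move to \<open>w + t * u\<close> with \<open>w\<close> off it: the new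
  form keeps the nonzero value \<open>L m w\<close> for every \<open>t\<close>, so only the old
  forms restrict \<open>t\<close>.\<close>

lemma exists_point_off_hyperplanes:
  fixes c :: "'i \<Rightarrow> nat \<Rightarrow> 'a::field"
  assumes "finite S"
    and "finite (UNIV :: 'a set) \<Longrightarrow> card S \<le> card (UNIV :: 'a set)"
    and "\<And>s. s \<in> S \<Longrightarrow> \<exists>k<n. c s k \<noteq> 0"
  shows "\<exists>u. \<forall>s\<in>S. (\<Sum>k<n. c s k * u k) \<noteq> 0"
  using assms
proof (induction S rule: finite_induct)
  case empty
  then show ?case by simp
next
  case (insert m S)
  define L where "L s u = (\<Sum>k<n. c s k * u k)" for s u
  have L_add: "L s (\<lambda>k. w k + t * u k) = L s w + t * L s u" for s w t u
    by (simp add: L_def distrib_left sum.distrib sum_distrib_left mult.left_commute)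
  have "\<exists>u. \<forall>s\<in>S. L s u \<noteq> 0"
    unfolding L_def using insert.prems insert.hyps by (intro insert.IH) auto
  then obtain u where u: "\<And>s. s \<in> S \<Longrightarrow> L s u \<noteq> 0" by blast
  show ?case
  proof (cases "L m u = 0")
    case False
    then show ?thesis using u by (auto simp: L_def)
  next
    case True
    obtain k where k: "k < n" "c m k \<noteq> 0" using insert.prems by auto
    define w where "w = (\<lambda>i. if i = k then 1 else 0 :: 'a)"
    have Lmw: "L m w \<noteq> 0"
      using k by (simp add: L_def w_def if_distrib [of "(*) _"] cong: if_cong)
    \<comment> \<open>Each \<open>s\<close> in \<open>S\<close> excludes exactly one
      \<open>t\<close>; over a finite field \<open>card S < |K|\<close>, so some \<open>t\<close>
      remains.\<close>
    let ?B = "(\<lambda>s. - L s w / L s u) ` S"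
    have "?B \<noteq> UNIV"
    proof
      assume B: "?B = UNIV"
      then have fin: "finite (UNIV :: 'a set)"
        using insert.hyps(1) by (metis finite_imageI)
      have "card (UNIV :: 'a set) \<le> card S"
        using card_image_le [OF insert.hyps(1), of "\<lambda>s. - L s w / L s u"] B by simp
      moreover have "Suc (card S) \<le> card (UNIV :: 'a set)"
        using insert.prems(1) [OF fin] insert.hyps by simp
      ultimately show False by simp
    qed
    then obtain t where t: "t \<notin> ?B" by blast
    have "L s (\<lambda>k. w k + t * u k) \<noteq> 0" if "s \<in> insert m S" for s
    proof (cases "s = m")
      case True
      then show ?thesis using \<open>L m u = 0\<close> Lmw by (simp add: L_add)
    next
      case False
      then have s: "s \<in> S" using that by simp
      then have "t \<noteq> - L s w / L s u" using t by blast
      then have "t * L s u \<noteq> - L s w" using u [OF s] 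
        by (metis nonzero_mult_div_cancel_right)
      then show ?thesis by (simp add: L_add eq_neg_iff_add_eq_0 add.commute)
    qed
    then show ?thesis
      unfolding L_def by (intro exI [of _ "\<lambda>k. w k + t * u k"] ballI)
  qed
qed

section \<open>Substituting univariate polynomials for the variables\<close>

definition monom_subst :: "(nat \<Rightarrow> 'b::comm_semiring_1) \<Rightarrow> (nat \<Rightarrow>\<^sub>0 nat) \<Rightarrow> 'b" where
  "monom_subst \<phi> t = (\<Prod>i\<in>Poly_Mapping.keys t. \<phi> i ^ Poly_Mapping.lookup t i)"

definition mpoly_subst :: "(nat \<Rightarrow> 'a::comm_semiring_1 poly) \<Rightarrow> 'a mpoly \<Rightarrow> 'a poly" where
  "mpoly_subst \<phi> p =
    (\<Sum>t\<in>Poly_Mapping.keys p. smult (Poly_Mapping.lookup p t) (monom_subst \<phi> t))"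

text \<open>Indices outside the support contribute \<open>\<phi> i ^ 0 = 1\<close>. This lets
  several monomials be evaluated over one common index set.\<close>

lemma monom_subst_superset:
  assumes "finite T" and "Poly_Mapping.keys t \<subseteq> T"
  shows "monom_subst \<phi> t = (\<Prod>i\<in>T. \<phi> i ^ Poly_Mapping.lookup t i)"
  unfolding monom_subst_def using assms
  by (intro prod.mono_neutral_left) (auto simp: in_keys_iff)

lemma monom_subst_add: "monom_subst \<phi> (s + t) = monom_subst \<phi> s * monom_subst \<phi> t"
proof -
  let ?T = "Poly_Mapping.keys s \<union> Poly_Mapping.keys t"
  have "Poly_Mapping.keys (s + t) \<subseteq> ?T" by (rule keys_add)
  then show ?thesis
    by (simp add: monom_subst_superset [of ?T] lookup_add power_add prod.distrib)
qed

lemma mpoly_subst_superset: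
  assumes "finite T" and "Poly_Mapping.keys p \<subseteq> T"
  shows "mpoly_subst \<phi> p = (\<Sum>t\<in>T. smult (Poly_Mapping.lookup p t) (monom_subst \<phi> t))"
  unfolding mpoly_subst_def using assms
  by (intro sum.mono_neutral_left) (auto simp: in_keys_iff)

lemma mpoly_subst_0 [simp]: "mpoly_subst \<phi> 0 = 0"
  by (simp add: mpoly_subst_def)

lemma mpoly_subst_single: "mpoly_subst \<phi> (Poly_Mapping.single t c) = smult c (monom_subst \<phi> t)"
  by (subst mpoly_subst_superset [of "{t}"]) auto

lemma mpoly_subst_1 [simp]: "mpoly_subst \<phi> 1 = 1"
  by (simp add: monom_subst_def mpoly_subst_single flip: single_one)

lemma mpoly_subst_add: "mpoly_subst \<phi> (p + q) = mpoly_subst \<phi> p + mpoly_subst \<phi> q"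
proof -
  let ?T = "Poly_Mapping.keys p \<union> Poly_Mapping.keys q"
  have "Poly_Mapping.keys (p + q) \<subseteq> ?T" by (rule keys_add)
  then show ?thesis
    by (simp add: mpoly_subst_superset [of ?T] lookup_add smult_add_left sum.distrib)
qed

lemma mpoly_subst_sum: "mpoly_subst \<phi> (\<Sum>i\<in>I. p i) = (\<Sum>i\<in>I. mpoly_subst \<phi> (p i))"
  by (induction I rule: infinite_finite_induct) (simp_all add: mpoly_subst_add)

text \<open>Reduces additive statements, such as multiplicativity of substitution, to single
  terms.\<close>

lemma mpoly_induct [case_names zero single add]:
  fixes p :: "'a::comm_monoid_add mpoly"
  assumes "P 0"
    and "\<And>t c. P (Poly_Mapping.single t c)"
    and "\<And>p q. P p \<Longrightarrow> P q \<Longrightarrow> P (p + q)"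
  shows "P p"
proof (induction p rule: update_induct)
  case const
  then show ?case by (rule assms(1))
next
  case (update p t c)
  \<comment> \<open>The key \<open>t\<close> is new, so overwriting its coefficient 0 is the same as
    adding a term.\<close>
  then have "Poly_Mapping.update t c p = p + Poly_Mapping.single t c"
    by (intro poly_mapping_eqI) (auto simp: lookup_update lookup_add lookup_single in_keys_iff when_def)
  then show ?case using assms(2,3) update by simp
qed

lemma mpoly_subst_mult: "mpoly_subst \<phi> (p * q) = mpoly_subst \<phi> p * mpoly_subst \<phi> q"
proof (induction p rule: mpoly_induct)
  case (single s a)
  show ?case
  proof (induction q rule: mpoly_induct)
    case (single t b)
    show ?case
      by (simp add: mult_single mpoly_subst_single monom_subst_add ac_simps)
  qed (simp_all add: distrib_left mpoly_subst_add)
qed (simp_all add: distrib_right mpoly_subst_add)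

lemma mpoly_subst_power: "mpoly_subst \<phi> (p ^ d) = mpoly_subst \<phi> p ^ d"
  by (induction d) (simp_all add: mpoly_subst_mult)

lemma mpoly_subst_scale: "mpoly_subst \<phi> (mpoly_scale c p) = smult c (mpoly_subst \<phi> p)"
  by (simp add: mpoly_scale_conv_mult mpoly_subst_mult mpoly_subst_single monom_subst_def)

section \<open>Linear forms\<close>

abbreviation lin_coeff :: "'a::zero mpoly \<Rightarrow> nat \<Rightarrow> 'a" where
  "lin_coeff f k \<equiv> Poly_Mapping.lookup f (Poly_Mapping.single k 1)"

lemma monom_degree_eq_1:
  assumes "monom_degree t = 1"
  obtains k where "t = Poly_Mapping.single k 1"
proof -
  have "(\<Sum>i\<in>Poly_Mapping.keys t. Poly_Mapping.lookup t i) = 1"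
    using assms by (simp add: monom_degree_def)
  then obtain k where k: "k \<in> Poly_Mapping.keys t" "Poly_Mapping.lookup t k = 1"
    "\<forall>j\<in>Poly_Mapping.keys t. k \<noteq> j \<longrightarrow> Poly_Mapping.lookup t j = 0"
    using sum_eq_1_iff [OF finite_keys [of t]] by blast
  then have "t = Poly_Mapping.single k 1"
    by (intro poly_mapping_eqI) (auto simp: lookup_single when_def in_keys_iff)
  then show ?thesis by (rule that)
qed

lemma linear_form_expand:
  fixes f :: "'a::comm_monoid_add mpoly"
  assumes "f \<in> forms n 1"
  shows "f = (\<Sum>k<n. Poly_Mapping.single (Poly_Mapping.single k 1) (lin_coeff f k))"
proof (rule poly_mapping_eqI)
  fix t
  have *: "Poly_Mapping.single k (1::nat) = Poly_Mapping.single j 1 \<longleftrightarrow> k = j" for k j :: nat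
    by (metis lookup_single_eq lookup_single_not_eq zero_neq_one)
  show "Poly_Mapping.lookup f t = Poly_Mapping.lookup
    (\<Sum>k<n. Poly_Mapping.single (Poly_Mapping.single k 1) (lin_coeff f k)) t"
  proof (cases "\<exists>k<n. t = Poly_Mapping.single k 1")
    case True
    then obtain k where "k < n" "t = Poly_Mapping.single k 1" by blast
    then show ?thesis
      using * by (simp add: lookup_sum lookup_single when_def)
  next
    case False
    have "t \<notin> Poly_Mapping.keys f"
    proof
      assume "t \<in> Poly_Mapping.keys f"
      then have "monom_degree t = 1" "Poly_Mapping.keys t \<subseteq> {..<n}"
        using assms by (auto simp: forms_def mpolys_def)
      then show False using False by (elim monom_degree_eq_1) auto
    qed
    moreover have "Poly_Mapping.lookup (Poly_Mapping.single (Poly_Mapping.single k 1) a) t = 0"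
      if "k < n" for k and a :: 'a
      using False that by (intro lookup_single_not_eq) blast
    ultimately show ?thesis
      by (simp add: lookup_sum in_keys_iff)
  qed
qed

lemma linear_form_eqI:
  fixes f g :: "'a::comm_monoid_add mpoly"
  assumes "f \<in> forms n 1" "g \<in> forms n 1" "\<And>k. k < n \<Longrightarrow> lin_coeff f k = lin_coeff g k"
  shows "f = g"
proof -
  have "f = (\<Sum>k<n. Poly_Mapping.single (Poly_Mapping.single k 1) (lin_coeff f k))"
    by (rule linear_form_expand [OF assms(1)])
  also have "\<dots> = (\<Sum>k<n. Poly_Mapping.single (Poly_Mapping.single k 1) (lin_coeff g k))"
    by (intro sum.cong refl) (simp only: lessThan_iff assms(3))
  also have "\<dots> = g"
    by (rule linear_form_expand [OF assms(2), symmetric])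
  finally show ?thesis .
qed

lemma mpoly_scale_forms:
  fixes f :: "'a::comm_semiring_1 mpoly"
  assumes "f \<in> forms n m"
  shows "mpoly_scale c f \<in> forms n m"
proof -
  have "Poly_Mapping.keys (mpoly_scale c f) \<subseteq> Poly_Mapping.keys f"
    by (auto simp: mpoly_scale_def in_keys_iff map.rep_eq when_def)
  then show ?thesis using assms by (auto simp: forms_def mpolys_def)
qed

lemma lookup_mpoly_scale [simp]:
  "Poly_Mapping.lookup (mpoly_scale c f) t = c * Poly_Mapping.lookup f t"
  by (simp add: mpoly_scale_def map.rep_eq when_def)

text \<open>Restriction to the line \<open>u + y v\<close>: the constant coefficient is f(u), and
  the coefficient of y is f(v).\<close>

lemma mpoly_subst_linear_form:
  fixes f :: "'a::comm_semiring_1 mpoly"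
  assumes "f \<in> forms n 1"
  shows "mpoly_subst (\<lambda>k. [:u k, v k:]) f =
    [:\<Sum>k<n. lin_coeff f k * u k, \<Sum>k<n. lin_coeff f k * v k:]"
proof -
  have "(\<Sum>k\<in>I. [:a k, b k:]) = [:\<Sum>k\<in>I. a k, \<Sum>k\<in>I. b k:]" for I :: "nat set" and a b :: "nat \<Rightarrow> 'a"
    by (induction I rule: infinite_finite_induct) simp_all
  then show ?thesis
    by (subst linear_form_expand [OF assms])
      (simp add: mpoly_subst_sum mpoly_subst_single monom_subst_def)
qed

section \<open>Powers of linear polynomials\<close>

text \<open>Combine the power sum relations with the coefficients of a Lagrange polynomial that
  vanishes at every node except \<open>x m\<close>; its degree is below \<open>card I\<close>, so
  only the given relations occur.\<close>

lemma vandermonde_trivial_kernel: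
  fixes x \<mu> :: "'i \<Rightarrow> 'a::field"
  assumes "finite I" and "inj_on x I"
    and "\<And>j. j < card I \<Longrightarrow> (\<Sum>i\<in>I. \<mu> i * x i ^ j) = 0"
    and "m \<in> I"
  shows "\<mu> m = 0"
proof -
  define p where "p = (\<Prod>i\<in>I - {m}. [:- x i, 1:])"
  have poly_p: "poly p y = (\<Prod>i\<in>I - {m}. y - x i)" for y
    by (simp add: p_def poly_prod)
  have "degree p \<le> card (I - {m})"
    unfolding p_def using degree_prod_sum_le [of "I - {m}" "\<lambda>i. [:- x i, 1:]"] assms(1)
    by simp
  also have "\<dots> < card I" using assms(1,4) by (rule card_Diff1_less)
  finally have deg: "degree p < card I" .
  have "(\<Sum>i\<in>I. \<mu> i * poly p (x i)) = (\<Sum>i\<in>I. \<Sum>j\<le>degree p. coeff p j * (\<mu> i * x i ^ j))"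
    by (simp add: poly_altdef sum_distrib_left mult.left_commute)
  also have "\<dots> = (\<Sum>j\<le>degree p. coeff p j * (\<Sum>i\<in>I. \<mu> i * x i ^ j))"
    by (subst sum.swap) (simp add: sum_distrib_left)
  also have "\<dots> = 0" using assms(3) deg by simp
  also have "(\<Sum>i\<in>I. \<mu> i * poly p (x i)) = \<mu> m * poly p (x m)"
  proof -
    have "(\<Sum>i\<in>I - {m}. \<mu> i * poly p (x i)) = 0"
      using assms(1) by (intro sum.neutral) (auto simp: poly_p)
    then show ?thesis using assms(1,4) by (simp add: sum.remove)
  qed
  finally have "\<mu> m * poly p (x m) = 0" .
  moreover have "poly p (x m) \<noteq> 0"
    using assms(1,2,4) by (auto simp: poly_p inj_on_def)
  ultimately show ?thesis by simp
qed

text \<open>The coefficient of y^j in (u + v y)^d is (d choose j) u^d (v/u)^j. Cancelling the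
  binomial leaves a Vandermonde system in the weights \<open>c i * u i ^ d\<close>.\<close>

lemma linear_powers_independent:
  fixes u v c :: "'i \<Rightarrow> 'a::field"
  assumes "finite I"
    and binom: "\<And>j. j < card I \<Longrightarrow> (of_nat (d choose j) :: 'a) \<noteq> 0"
    and u: "\<And>i. i \<in> I \<Longrightarrow> u i \<noteq> 0"
    and inj: "inj_on (\<lambda>i. v i / u i) I"
    and sum: "(\<Sum>i\<in>I. smult (c i) ([:u i, v i:] ^ d)) = 0"
    and "m \<in> I"
  shows "c m = 0"
proof -
  have "c m * u m ^ d = 0"
  proof (rule vandermonde_trivial_kernel [OF assms(1) inj _ \<open>m \<in> I\<close>, where \<mu> = "\<lambda>i. c i * u i ^ d"])
    fix j assume j: "j < card I"
    \<comment> \<open>For \<open>j > d\<close> the binomial would be 0; hence \<open>d - j\<close>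
      below is a true difference.\<close>
    have "j \<le> d" using binom [OF j] by (metis binomial_eq_0 not_le of_nat_0)
    have "0 = (\<Sum>i\<in>I. c i * coeff ([:u i, v i:] ^ d) j)"
      using arg_cong [OF sum, of "\<lambda>p. coeff p j"] by (simp add: coeff_sum)
    also have "\<dots> = of_nat (d choose j) * (\<Sum>i\<in>I. c i * u i ^ d * (v i / u i) ^ j)"
      unfolding sum_distrib_left
    proof (rule sum.cong)
      fix i assume "i \<in> I"
      have "u i ^ d = u i ^ (d - j) * u i ^ j"
        using \<open>j \<le> d\<close> by (simp flip: power_add)
      then show "c i * coeff ([:u i, v i:] ^ d) j =
          of_nat (d choose j) * (c i * u i ^ d * (v i / u i) ^ j)"
        using u [OF \<open>i \<in> I\<close>] \<open>j \<le> d\<close>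
        by (simp add: coeff_linear_poly_power power_divide field_simps)
    qed simp
    finally show "(\<Sum>i\<in>I. c i * u i ^ d * (v i / u i) ^ j) = 0"
      using binom [OF j] by simp
  qed
  then show ?thesis using u [OF \<open>m \<in> I\<close>] by simp
qed

section \<open>Powerpoints\<close>

text \<open>The \<open>d\<close>-th power is multiplied by \<open>c ^ d\<close>, again nonzero.
  Hence forms with distinct powerpoints are not proportional.\<close>

lemma powerpoint_scale:
  fixes f :: "'a::field mpoly"
  assumes "c \<noteq> 0"
  shows "powerpoint d (mpoly_scale c f) = powerpoint d f"
proof -
  have "mpoly_scale c f ^ d = mpoly_scale (c ^ d) (f ^ d)"
    by (induction d) (simp_all add: mpoly_scale_conv_mult mult_ac mult_single)
  then show ?thesis
    using assms mpoly.span_image_scale [of "{f ^ d}" "\<lambda>_. c ^ d"] by (simp add: powerpoint_def)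
qed

lemma card_ordered_pairs_le: "2 * card (SIGMA i:{1..m}. {1..<i}) \<le> m\<^sup>2" for m :: nat
proof -
  have "2 * (\<Sum>i=1..m. i - 1) \<le> m\<^sup>2"
    by (induction m) (simp_all add: power2_eq_square)
  then show ?thesis by simp
qed

theorem theorem3p2:
  fixes d n r :: nat and f :: "nat \<Rightarrow> 'a::field mpoly"
  assumes "d > 1" and "n > 1"
    and "finite (UNIV :: 'a set) \<Longrightarrow> real (card (UNIV :: 'a set)) > (real r + 1)\<^sup>2 / 2"
    and "\<And>i. i \<le> r \<Longrightarrow> (of_nat (d choose i) :: 'a) \<noteq> 0"
    and "\<And>i. i \<in> {1..r+1} \<Longrightarrow> f i \<in> forms n 1 \<and> f i \<noteq> 0"
    and "inj_on (\<lambda>i. powerpoint d (f i)) {1..r+1}"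
  shows "inj_on (\<lambda>i. f i ^ d) {1..r+1} \<and> mpoly.independent ((\<lambda>i. f i ^ d) ` {1..r+1})"
proof -
  define I where "I = {1..r+1}"
  have I: "finite I" "card I = r + 1" by (simp_all add: I_def)
  have f: "f i \<in> forms n 1" "f i \<noteq> 0" if "i \<in> I" for i
    using assms(5) that by (auto simp: I_def)
  have inj: "inj_on (\<lambda>i. powerpoint d (f i)) I" using assms(6) by (simp add: I_def)
  define L where "L i u = (\<Sum>k<n. lin_coeff (f i) k * u k)" for i u
  \<comment> \<open>Each unordered pair is listed once, with \<open>j < i\<close>; this keeps the
    count at r (r + 1) / 2, within the bound on |K|.\<close>
  define S where "S = (SIGMA i:I. {1..<i})"
  have bound: "(r + 1)\<^sup>2 < 2 * card (UNIV :: 'a set)" if "finite (UNIV :: 'a set)"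
  proof -
    have "real ((r + 1)\<^sup>2) < real (2 * card (UNIV :: 'a set))"
      using assms(3) [OF that] by (simp add: add.commute)
    then show ?thesis by (simp only: of_nat_less_iff)
  qed
  have "\<exists>u. \<forall>i\<in>I. (\<Sum>k<n. lin_coeff (f i) k * u k) \<noteq> 0"
  proof (rule exists_point_off_hyperplanes [OF I(1)])
    assume "finite (UNIV :: 'a set)"
    \<comment> \<open>With \<open>bound\<close> this gives 2 r + 1 < 2 |K|, hence r + 1 \<le> |K|
      for integers.\<close>
    have "2 * r + 1 \<le> (r + 1)\<^sup>2" by (simp add: power2_eq_square)
    with bound [OF \<open>finite UNIV\<close>] show "card I \<le> card (UNIV :: 'a set)"
      unfolding I(2) by linarith
  next
    fix i assume i: "i \<in> I"
    show "\<exists>k<n. lin_coeff (f i) k \<noteq> 0"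
    proof (rule ccontr)
      assume "\<not> ?thesis"
      then have "f i = 0"
        by (intro linear_form_eqI [of _ n] f(1) i) (auto simp: forms_def mpolys_def)
      then show False using f(2) [OF i] by simp
    qed
  qed
  then obtain u where u: "\<And>i. i \<in> I \<Longrightarrow> L i u \<noteq> 0" unfolding L_def by blast
  define c where
    "c = (\<lambda>(i, j) k. L j u * lin_coeff (f i) k - L i u * lin_coeff (f j) k)"
  have "\<exists>v. \<forall>s\<in>S. (\<Sum>k<n. c s k * v k) \<noteq> 0"
  proof (rule exists_point_off_hyperplanes)
    show "finite S" by (simp add: S_def I(1))
    assume "finite (UNIV :: 'a set)"
    from bound [OF this] card_ordered_pairs_le [of "r + 1"] show "card S \<le> card (UNIV :: 'a set)"
      unfolding S_def I_def by linarith
  next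
    fix s assume "s \<in> S"
    then obtain i j where s: "s = (i, j)" and ij: "i \<in> I" "j \<in> I" "i \<noteq> j"
      by (auto simp: S_def I_def)
    show "\<exists>k<n. c s k \<noteq> 0"
    proof (rule ccontr)
      assume "\<not> ?thesis"
      \<comment> \<open>Vanishing of all \<open>c s k\<close> makes \<open>f i\<close> and
        \<open>f j\<close> proportional; the ratio is nonzero because \<open>u\<close> avoids both
        hyperplanes.\<close>
      then have "f i = mpoly_scale (L i u / L j u) (f j)"
        using u ij by (intro linear_form_eqI [of _ n] mpoly_scale_forms f(1))
          (auto simp: c_def s field_simps)
      then have "powerpoint d (f i) = powerpoint d (f j)"
        using u ij by (simp add: powerpoint_scale)
      then show False using inj ij by (auto simp: inj_on_def)
    qed
  qed
  then obtain v where v: "\<And>s. s \<in> S \<Longrightarrow> (\<Sum>k<n. c s k * v k) \<noteq> 0" by blast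
  have sum_c: "(\<Sum>k<n. c (i, j) k * v k) = L j u * L i v - L i u * L j v" for i j
    by (simp add: c_def L_def [of _ v] sum_subtractf left_diff_distrib sum_distrib_left mult.assoc)
  \<comment> \<open>Cross-multiplying by the nonzero \<open>L i u\<close> and \<open>L j u\<close>,
    equal nodes would make the form \<open>c (i, j)\<close> vanish at \<open>v\<close>.\<close>
  have nodes_lt: "L i v / L i u \<noteq> L j v / L j u" if "i \<in> I" "j \<in> I" "j < i" for i j
    using v [of "(i, j)"] u that unfolding sum_c
    by (auto simp: S_def I_def frac_eq_eq mult.commute)
  have nodes: "inj_on (\<lambda>i. L i v / L i u) I"
    by (rule inj_onI) (metis nodes_lt linorder_neq_iff)
  \<comment> \<open>A powerpoint depends on \<open>f i\<close> only through \<open>f i ^ d\<close>,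
    so distinct powerpoints have distinct powers. Sums over the image can then be reindexed by
    \<open>I\<close>.\<close>
  have inj_pow: "inj_on (\<lambda>i. f i ^ d) I"
    using inj by (auto simp: inj_on_def powerpoint_def)
  have "a (f m ^ d) = 0"
    if "(\<Sum>x\<in>(\<lambda>i. f i ^ d) ` I. mpoly_scale (a x) x) = 0" and m: "m \<in> I" for a m
  proof -
    \<comment> \<open>Restricting the relation to the line through \<open>u\<close> in direction
      \<open>v\<close> gives a relation among powers of linear polynomials in one variable.\<close>
    have "0 = mpoly_subst (\<lambda>k. [:u k, v k:]) (\<Sum>i\<in>I. mpoly_scale (a (f i ^ d)) (f i ^ d))"
      using that(1) by (simp add: sum.reindex [OF inj_pow])
    also have "\<dots> = (\<Sum>i\<in>I. smult (a (f i ^ d)) ([:L i u, L i v:] ^ d))"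
      by (simp add: mpoly_subst_sum mpoly_subst_scale mpoly_subst_power
          mpoly_subst_linear_form [OF f(1)] L_def)
    finally show ?thesis
      using I assms(4) u nodes m
      by (intro linear_powers_independent [where c = "\<lambda>i. a (f i ^ d)" and I = I and d = d
            and u = "\<lambda>i. L i u" and v = "\<lambda>i. L i v"]) auto
  qed
  then have "mpoly.independent ((\<lambda>i. f i ^ d) ` I)"
    using I(1) by (intro mpoly.independent_if_scalars_zero) auto
  with inj_pow show ?thesis by (simp add: I_def)
qed

end
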